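(* The ai-semiring $TR_6$ is nonfinitely based, but it is not strongly nonfinitely based.
   Context: An additively idempotent semiring (ai-semiring) is an algebra $(S,+,\cdot)$ such that $(S,+)$ is a commutative idempotent semigroup, $(S,\cdot)$ is a semigroup, and $x(y+z)\approx xy+xz$, $(x+y)z\approx xz+yz$ hold. A variety of ai-semirings is a class of ai-semirings closed under subalgebras, homomorphic images and arbitrary direct products (equivalently, a class of ai-semirings defined by identities in the signature $\{+,\cdot\}$); $\mathsf{V}(A)$ denotes the variety generated by $A$. A variety is finitely based if it is defined by some finite set of identities, and nonfinitely based otherwise; an ai-semiring $A$ is (non)finitely based if $\mathsf{V}(A)$ is. A variety is finitely generated if it equals $\mathsf{V}(A)$ for some finite ai-semiring $A$. A finite ai-semiring is strongly nonfinitely based (SNFB) if every finitely generated variety of ai-semirings containing it is nonfinitely based (that is, it belongs to no finitely based finitely generated variety). $TR_6$ is the ai-semiring on $\{1,2,3,4,5,6\}$ with the following operations. Addition is commutative and idempotent, with $1+a=1$ for all $a$, $2+5=2$, $4+6=4$, and every other sum of two distinct elements of $\{2,3,4,5,6\}$ equal to $3$. Multiplication is commutative, with $2\cdot 6=4\cdot 5=5\cdot 6=3$ and every other product equal to $1$. *)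

theory Defs
  imports Main
begin

record 'a sralg =
  carrier :: "'a set"
  add :: "'a \<Rightarrow> 'a \<Rightarrow> 'a" (infixl "\<oplus>\<index>" 65)
  mult :: "'a \<Rightarrow> 'a \<Rightarrow> 'a" (infixl "\<otimes>\<index>" 70)

locale ai_semiring =
  fixes S :: "'a sralg" (structure)
  assumes nonempty: "carrier S \<noteq> {}"
    and add_closed: "\<lbrakk>x \<in> carrier S; y \<in> carrier S\<rbrakk> \<Longrightarrow> x \<oplus> y \<in> carrier S"
    and mult_closed: "\<lbrakk>x \<in> carrier S; y \<in> carrier S\<rbrakk> \<Longrightarrow> x \<otimes> y \<in> carrier S"
    and add_assoc: "\<lbrakk>x \<in> carrier S; y \<in> carrier S; z \<in> carrier S\<rbrakk>
                      \<Longrightarrow> (x \<oplus> y) \<oplus> z = x \<oplus> (y \<oplus> z)"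
    and add_comm: "\<lbrakk>x \<in> carrier S; y \<in> carrier S\<rbrakk> \<Longrightarrow> x \<oplus> y = y \<oplus> x"
    and add_idem: "x \<in> carrier S \<Longrightarrow> x \<oplus> x = x"
    and mult_assoc: "\<lbrakk>x \<in> carrier S; y \<in> carrier S; z \<in> carrier S\<rbrakk>
                      \<Longrightarrow> (x \<otimes> y) \<otimes> z = x \<otimes> (y \<otimes> z)"
    and distrib_left: "\<lbrakk>x \<in> carrier S; y \<in> carrier S; z \<in> carrier S\<rbrakk>
                      \<Longrightarrow> x \<otimes> (y \<oplus> z) = x \<otimes> y \<oplus> x \<otimes> z"
    and distrib_right: "\<lbrakk>x \<in> carrier S; y \<in> carrier S; z \<in> carrier S\<rbrakk>
                      \<Longrightarrow> (x \<oplus> y) \<otimes> z = x \<otimes> z \<oplus> y \<otimes> z"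

definition isomorphic :: "'a sralg \<Rightarrow> 'b sralg \<Rightarrow> bool" where
  "isomorphic S T \<longleftrightarrow> (\<exists>h. bij_betw h (carrier S) (carrier T) \<and>
     (\<forall>x\<in>carrier S. \<forall>y\<in>carrier S.
        h (x \<oplus>\<^bsub>S\<^esub> y) = h x \<oplus>\<^bsub>T\<^esub> h y \<and> h (x \<otimes>\<^bsub>S\<^esub> y) = h x \<otimes>\<^bsub>T\<^esub> h y))"

datatype srterm = Var nat | Add srterm srterm | Mult srterm srterm

type_synonym identity = "srterm \<times> srterm"

fun eval :: "'a sralg \<Rightarrow> (nat \<Rightarrow> 'a) \<Rightarrow> srterm \<Rightarrow> 'a" where
  "eval S \<rho> (Var i) = \<rho> i"
| "eval S \<rho> (Add s t) = eval S \<rho> s \<oplus>\<^bsub>S\<^esub> eval S \<rho> t"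
| "eval S \<rho> (Mult s t) = eval S \<rho> s \<otimes>\<^bsub>S\<^esub> eval S \<rho> t"

definition satisfies :: "'a sralg \<Rightarrow> identity \<Rightarrow> bool" where
  "satisfies S e \<longleftrightarrow> (\<forall>\<rho>. range \<rho> \<subseteq> carrier S \<longrightarrow> eval S \<rho> (fst e) = eval S \<rho> (snd e))"

text \<open>
  Proper classes of algebras are rendered by sets of algebras whose carriers are subsets
  of a type \<open>'u\<close>, the universe. Since a universe is not closed under arbitrary direct products,
  varieties are taken as the classes defined by identities. The notions below are intended for
  infinite \<open>'u\<close>: such a universe contains copies of all countable algebras, in particular of
  the free ai-semirings of countable rank, so that distinct varieties have distinct
  restrictions to it.
\<close>

definition defined_by :: "identity set \<Rightarrow> 'u sralg set" where
  "defined_by \<Sigma> = {S. ai_semiring S \<and> (\<forall>e\<in>\<Sigma>. satisfies S e)}"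

definition variety :: "'u sralg set \<Rightarrow> bool" where
  "variety V \<longleftrightarrow> (\<exists>\<Sigma>. V = defined_by \<Sigma>)"

definition generated_variety :: "'u sralg \<Rightarrow> 'u sralg set" where
  "generated_variety A = \<Inter>{V. variety V \<and> A \<in> V}"

definition finitely_based_variety :: "'u sralg set \<Rightarrow> bool" where
  "finitely_based_variety V \<longleftrightarrow> (\<exists>\<Sigma>. finite \<Sigma> \<and> V = defined_by \<Sigma>)"

definition finitely_based :: "'u sralg \<Rightarrow> bool" where
  "finitely_based A \<longleftrightarrow> finitely_based_variety (generated_variety A)"

definition finitely_generated_variety :: "'u sralg set \<Rightarrow> bool" where
  "finitely_generated_variety V \<longleftrightarrow>
     (\<exists>A. ai_semiring A \<and> finite (carrier A) \<and> V = generated_variety A)"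

text \<open>Used for finite ai-semirings only.\<close>

definition strongly_nonfinitely_based :: "'u sralg \<Rightarrow> bool" where
  "strongly_nonfinitely_based A \<longleftrightarrow>
     (\<forall>V. finitely_generated_variety V \<and> A \<in> V \<longrightarrow> \<not> finitely_based_variety V)"

definition TR6 :: "nat sralg" where
  "TR6 = \<lparr>carrier = {1, 2, 3, 4, 5, 6},
          add = (\<lambda>a b. if a = b then a
                       else if a = 1 \<or> b = 1 then 1
                       else if {a, b} = {2, 5} then 2
                       else if {a, b} = {4, 6} then 4
                       else 3),
          mult = (\<lambda>a b. if {a, b} \<in> {{2, 6}, {4, 5}, {5, 6}} then 3 else 1)\<rparr>"

lemma ai_semiring_TR6: "ai_semiring TR6"
proof -
  define p where "p = (\<lambda>a b. a \<oplus>\<^bsub>TR6\<^esub> b)"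
  define m where "m = (\<lambda>a b. a \<otimes>\<^bsub>TR6\<^esub> b)"
  define C where "C = carrier TR6"
  have C: "C = {1, 2, 3, 4, 5, 6}"
    by (simp add: C_def TR6_def)
  have p: "p a b = (if a = b then a else if a = 1 \<or> b = 1 then 1
      else if a = 2 \<and> b = 5 \<or> a = 5 \<and> b = 2 then 2
      else if a = 4 \<and> b = 6 \<or> a = 6 \<and> b = 4 then 4 else 3)" for a b
    by (auto simp: p_def TR6_def doubleton_eq_iff)
  have m: "m a b = (if a = 2 \<and> b = 6 \<or> a = 6 \<and> b = 2 \<or> a = 4 \<and> b = 5 \<or> a = 5 \<and> b = 4
      \<or> a = 5 \<and> b = 6 \<or> a = 6 \<and> b = 5 then 3 else 1)" for a b
    by (auto simp: m_def TR6_def doubleton_eq_iff)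
  have "\<forall>x\<in>C. \<forall>y\<in>C. p x y \<in> C" "\<forall>x\<in>C. \<forall>y\<in>C. m x y \<in> C"
    "\<forall>x\<in>C. \<forall>y\<in>C. p x y = p y x" "\<forall>x\<in>C. p x x = x"
    "\<forall>x\<in>C. \<forall>y\<in>C. \<forall>z\<in>C. p (p x y) z = p x (p y z)"
    "\<forall>x\<in>C. \<forall>y\<in>C. \<forall>z\<in>C. m (m x y) z = m x (m y z)"
    "\<forall>x\<in>C. \<forall>y\<in>C. \<forall>z\<in>C. m x (p y z) = p (m x y) (m x z)"
    "\<forall>x\<in>C. \<forall>y\<in>C. \<forall>z\<in>C. m (p x y) z = p (m x z) (m y z)"
    unfolding C by (simp_all add: p m)
  moreover have "C \<noteq> {}"
    by (simp add: C)
  ultimately show ?thesis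
    unfolding ai_semiring_def p_def m_def C_def by blast
qed

lemma variety_generated_variety:
  assumes "ai_semiring A"
  shows "variety (generated_variety A)" and "A \<in> generated_variety A"
proof -
  have "generated_variety A = defined_by {e. satisfies A e}"
    using assms unfolding generated_variety_def variety_def defined_by_def by auto
  then show "variety (generated_variety A)"
    unfolding variety_def by blast
  show "A \<in> generated_variety A"
    unfolding generated_variety_def by blast
qed

text \<open>Every infinite universe contains a copy of \<^const>\<open>TR6\<close>.\<close>

lemma ex_isomorphic_TR6:
  assumes "infinite (UNIV :: 'u set)"
  shows "\<exists>T :: 'u sralg. ai_semiring T \<and> isomorphic T TR6"
proof -
  obtain f :: "nat \<Rightarrow> 'u" where f: "inj f"
    using assms infinite_countable_subset by blast
  define g where "g = inv f"
  have g: "g (f n) = n" for n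
    using f by (simp add: g_def)
  define T where "T = \<lparr>carrier = f ` carrier TR6,
    add = (\<lambda>x y. f (g x \<oplus>\<^bsub>TR6\<^esub> g y)), mult = (\<lambda>x y. f (g x \<otimes>\<^bsub>TR6\<^esub> g y))\<rparr>"
  have "bij_betw g (carrier T) (carrier TR6)"
    by (rule bij_betw_byWitness[where f' = f]) (auto simp: T_def g)
  then have "isomorphic T TR6"
    unfolding isomorphic_def by (intro exI[of _ g]) (auto simp: T_def g)
  moreover interpret TR6: ai_semiring TR6
    by (rule ai_semiring_TR6)
  have "ai_semiring T"
    using TR6.nonempty
    by unfold_locales
      (auto simp: T_def g inj_eq[OF f] TR6.add_closed TR6.mult_closed TR6.add_assoc TR6.add_idem
        TR6.mult_assoc TR6.distrib_left TR6.distrib_right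
        intro: TR6.add_comm)
  ultimately show ?thesis by blast
qed

end

theory Submission
  imports Defs
begin

text \<open>By distributivity a term is a finite sum of words, so an identity holds in an ai-semiring iff every
word of one side lies below the other side and conversely. In \<^const>\<open>TR6\<close> every word of length
at least three takes only the value \<open>1\<close>, the largest element. A term \<open>t\<close> without such words is a
graph: its words of length two are the edges, its words of length one are marked vertices. The
value of \<open>t\<close> differs from \<open>1\<close> only if the assignment maps each edge to an edge of the path
\<open>2 - 6 - 5 - 4\<close>, which is possible only if the graph is 2-colourable.

There are thus two sources of identities of \<^const>\<open>TR6\<close>. If the graph of \<open>t\<close> is 2-colourable, the
path has enough vertices to separate \<open>t\<close> from every word except those that lie below \<open>t\<close> for
trivial reasons, by \<open>x y = y x\<close> and \<open>x \<le> x y\<close> (\<open>TR6_word_dominated\<close>). If it is not, then \<open>t\<close> is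
identically \<open>1\<close>; in particular the sum of the edges of an odd cycle is above everything.

The odd cycles make the identities nonfinitely based. From the cycle with \<open>n\<close> vertices one builds
an ai-semiring in which the cycle sum is not the largest element, since the cycle maps to itself.
A graph with fewer than \<open>n\<close> vertices misses a vertex of the cycle when it is mapped there; what
remains is a path, so the graph is 2-colourable and only the trivial kind of identity is at stake.
Hence the algebra satisfies all identities of \<^const>\<open>TR6\<close> in fewer than \<open>n\<close> variables
(\<open>cycle_algebra_satisfies\<close>), but not the one of the cycle (\<open>cycle_algebra_not_satisfies\<close>).

The obstruction disappears as soon as the target graph has a loop, for then every graph can be
mapped to it. The four-element chain below comes from the graph with an edge between two vertices
and a loop at one of them. Four identities suffice to derive all of its identities
(\<open>chain_basis_complete\<close>), and \<^const>\<open>TR6\<close> satisfies these four: two of them are commutativity and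
\<open>x \<le> x y\<close>, and the others hold because squares and products of three factors are \<open>1\<close> there. So \<^const>\<open>TR6\<close> lies in a finitely based finitely generated variety.\<close>

section \<open>Terms as sums of words\<close>

definition leq :: "'a sralg \<Rightarrow> 'a \<Rightarrow> 'a \<Rightarrow> bool" where
  "leq S x y \<longleftrightarrow> x \<oplus>\<^bsub>S\<^esub> y = y"

fun words :: "srterm \<Rightarrow> nat list set" where
  "words (Var i) = {[i]}"
| "words (Add s t) = words s \<union> words t"
| "words (Mult s t) = {u @ v | u v. u \<in> words s \<and> v \<in> words t}"

text \<open>The empty word has no value, as semigroups need not have a unit.\<close>

fun word_val :: "'a sralg \<Rightarrow> (nat \<Rightarrow> 'a) \<Rightarrow> nat list \<Rightarrow> 'a" where
  "word_val S \<rho> [] = undefined"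
| "word_val S \<rho> [x] = \<rho> x"
| "word_val S \<rho> (x # y # w) = \<rho> x \<otimes>\<^bsub>S\<^esub> word_val S \<rho> (y # w)"

lemma words_not_Nil: "[] \<notin> words t"
  by (induction t) auto

lemma word_length_cases:
  assumes "w \<noteq> []"
  obtains x where "w = [x]" | x y where "w = [x, y]" | x y z v where "w = x # y # z # v"
proof -
  obtain x v where w: "w = x # v" using assms by (cases w) simp_all
  show thesis
  proof (cases v)
    case Nil
    then show thesis using that(1) w by blast
  next
    case (Cons y v')
    then show thesis using that(2)[of x y] that(3)[of x y] w by (cases v') blast+
  qed
qed

lemma short_word_cases:
  assumes "w \<in> words t" "length w \<le> 2"
  obtains x where "w = [x]" | x y where "w = [x, y]"
proof -
  have "w \<noteq> []" using assms(1) words_not_Nil by metis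
  then show thesis
    by (cases w rule: word_length_cases) (use assms(2) that in simp_all)
qed

lemma finite_words: "finite (words t)"
proof (induction t)
  case (Mult s t)
  have "words (Mult s t) = (\<lambda>(u, v). u @ v) ` (words s \<times> words t)"
    by auto
  then show ?case using Mult by simp
qed auto

lemma ex_term_with_word: "w \<noteq> [] \<Longrightarrow> \<exists>t. words t = {w}"
proof (induction w rule: list_nonempty_induct)
  case (single x)
  have "words (Var x) = {[x]}" by simp
  then show ?case by blast
next
  case (cons x w)
  then obtain t where "words t = {w}" by blast
  then have "words (Mult (Var x) t) = {x # w}" by simp
  then show ?case by blast
qed

lemma ex_term_with_words:
  assumes "finite W" "W \<noteq> {}" "[] \<notin> W"
  shows "\<exists>t. words t = W"
  using assms
proof (induction rule: finite_ne_induct)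
  case (singleton w)
  then show ?case using ex_term_with_word by simp
next
  case (insert w W)
  then obtain t where "words t = W" by auto
  moreover from insert ex_term_with_word[of w] obtain r where "words r = {w}" by auto
  ultimately have "words (Add r t) = insert w W" by simp
  then show ?case by blast
qed

context ai_semiring
begin

lemma leq_refl: "x \<in> carrier S \<Longrightarrow> leq S x x"
  by (simp add: leq_def add_idem)

lemma leq_antisym: "\<lbrakk>x \<in> carrier S; y \<in> carrier S; leq S x y; leq S y x\<rbrakk> \<Longrightarrow> x = y"
  by (metis leq_def add_comm)

lemma leq_trans:
  "\<lbrakk>x \<in> carrier S; y \<in> carrier S; z \<in> carrier S; leq S x y; leq S y z\<rbrakk> \<Longrightarrow> leq S x z"
  by (metis leq_def add_assoc)

lemma add_leq_iff:
  assumes "x \<in> carrier S" "y \<in> carrier S" "z \<in> carrier S"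
  shows "leq S (x \<oplus> y) z \<longleftrightarrow> leq S x z \<and> leq S y z"
proof
  assume *: "leq S (x \<oplus> y) z"
  have "leq S x (x \<oplus> y)" "leq S y (x \<oplus> y)"
    using assms by (metis leq_def add_assoc add_comm add_idem)+
  then show "leq S x z \<and> leq S y z"
    using * assms leq_trans add_closed by meson
next
  assume "leq S x z \<and> leq S y z"
  then show "leq S (x \<oplus> y) z"
    using assms by (simp add: leq_def add_assoc)
qed

lemma eval_closed: "range \<rho> \<subseteq> carrier S \<Longrightarrow> eval S \<rho> t \<in> carrier S"
  by (induction t) (auto simp: add_closed mult_closed)

lemma word_val_closed: "\<lbrakk>range \<rho> \<subseteq> carrier S; w \<noteq> []\<rbrakk> \<Longrightarrow> word_val S \<rho> w \<in> carrier S"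
  by (induction w rule: induct_list012) (simp_all add: mult_closed range_subsetD)

lemma word_val_append:
  assumes "range \<rho> \<subseteq> carrier S" "u \<noteq> []" "v \<noteq> []"
  shows "word_val S \<rho> (u @ v) = word_val S \<rho> u \<otimes> word_val S \<rho> v"
  using assms(2)
proof (induction u rule: list_nonempty_induct)
  case (single x)
  then show ?case using assms(3) by (cases v) auto
next
  case (cons x u)
  then obtain y u' where u: "u = y # u'" by (cases u) auto
  have "\<rho> x \<in> carrier S" "word_val S \<rho> u \<in> carrier S" "word_val S \<rho> v \<in> carrier S"
    using assms cons word_val_closed by auto
  then show ?case using cons u by (simp add: mult_assoc)
qed

text \<open>The value of a term is the least upper bound of the values of its words. For an induction through
products the claim has to be stable under multiplication by a further factor from either side; an
arbitrary additive map \<open>C\<close> covers both sides at once, since \<open>x \<mapsto> C (a x)\<close> and \<open>x \<mapsto> C (x b)\<close> are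
again additive.\<close>

lemma additive_eval_leq_iff:
  assumes \<rho>: "range \<rho> \<subseteq> carrier S" and z: "z \<in> carrier S"
    and C: "\<And>x. x \<in> carrier S \<Longrightarrow> C x \<in> carrier S"
      "\<And>x y. \<lbrakk>x \<in> carrier S; y \<in> carrier S\<rbrakk> \<Longrightarrow> C (x \<oplus> y) = C x \<oplus> C y"
  shows "leq S (C (eval S \<rho> t)) z \<longleftrightarrow> (\<forall>w\<in>words t. leq S (C (word_val S \<rho> w)) z)"
  using C
proof (induction t arbitrary: C)
  case (Var i)
  then show ?case by simp
next
  case (Add s t)
  then show ?case
    using eval_closed[OF \<rho>] z by (simp add: add_leq_iff ball_Un)
next
  case (Mult s t)
  note E = eval_closed[OF \<rho>]
  have W: "word_val S \<rho> w \<in> carrier S" if "w \<in> words r" for w r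
    using word_val_closed[OF \<rho>] words_not_Nil that by metis
  have "leq S (C (eval S \<rho> s \<otimes> eval S \<rho> t)) z
      \<longleftrightarrow> (\<forall>v\<in>words t. leq S (C (eval S \<rho> s \<otimes> word_val S \<rho> v)) z)"
    by (rule Mult.IH(2)) (use Mult.prems E in \<open>simp_all add: distrib_left mult_closed\<close>)
  also have "\<dots> \<longleftrightarrow> (\<forall>v\<in>words t. \<forall>u\<in>words s. leq S (C (word_val S \<rho> u \<otimes> word_val S \<rho> v)) z)"
  proof (rule ball_cong[OF refl])
    fix v assume "v \<in> words t"
    then have "word_val S \<rho> v \<in> carrier S" by (rule W)
    then show "leq S (C (eval S \<rho> s \<otimes> word_val S \<rho> v)) z
      \<longleftrightarrow> (\<forall>u\<in>words s. leq S (C (word_val S \<rho> u \<otimes> word_val S \<rho> v)) z)"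
      by (intro Mult.IH(1)[where C = "\<lambda>x. C (x \<otimes> word_val S \<rho> v)"])
        (use Mult.prems in \<open>simp_all add: distrib_right mult_closed\<close>)
  qed
  also have "\<dots> \<longleftrightarrow> (\<forall>w\<in>words (Mult s t). leq S (C (word_val S \<rho> w)) z)"
  proof -
    have "word_val S \<rho> (u @ v) = word_val S \<rho> u \<otimes> word_val S \<rho> v"
      if "u \<in> words s" "v \<in> words t" for u v
      using that word_val_append[OF \<rho>] words_not_Nil by metis
    then show ?thesis by (fastforce simp del: word_val.simps)
  qed
  finally show ?case by simp
qed

lemma eval_leq_iff:
  assumes "range \<rho> \<subseteq> carrier S" "z \<in> carrier S"
  shows "leq S (eval S \<rho> t) z \<longleftrightarrow> (\<forall>w\<in>words t. leq S (word_val S \<rho> w) z)"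
  using additive_eval_leq_iff[of \<rho> z "\<lambda>x. x" t] assms by simp

lemma word_leq_eval:
  assumes "range \<rho> \<subseteq> carrier S" "w \<in> words t"
  shows "leq S (word_val S \<rho> w) (eval S \<rho> t)"
  using assms eval_leq_iff[OF assms(1) eval_closed[OF assms(1)]] leq_refl eval_closed by blast

lemma satisfies_wordsI:
  assumes "\<And>\<rho> w. \<lbrakk>range \<rho> \<subseteq> carrier S; w \<in> words s\<rbrakk> \<Longrightarrow> leq S (word_val S \<rho> w) (eval S \<rho> t)"
    and "\<And>\<rho> w. \<lbrakk>range \<rho> \<subseteq> carrier S; w \<in> words t\<rbrakk> \<Longrightarrow> leq S (word_val S \<rho> w) (eval S \<rho> s)"
  shows "satisfies S (s, t)"
  unfolding satisfies_def fst_conv snd_conv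
  by (intro allI impI leq_antisym) (use assms in \<open>auto simp: eval_leq_iff eval_closed\<close>)

text \<open>How identities are refuted: if an assignment keeps all words of one side below \<open>z\<close>, then it keeps
every word of the other side below \<open>z\<close>.\<close>

lemma satisfies_word_leq:
  assumes "satisfies S (s, t)" "range \<rho> \<subseteq> carrier S" "z \<in> carrier S" "w \<in> words s"
    and "\<And>u. u \<in> words t \<Longrightarrow> leq S (word_val S \<rho> u) z"
  shows "leq S (word_val S \<rho> w) z"
proof -
  have "leq S (eval S \<rho> t) z"
    using assms(2,3,5) by (simp add: eval_leq_iff)
  then have "leq S (eval S \<rho> s) z"
    using assms(1,2) by (simp add: satisfies_def)
  then show ?thesis
    using assms(2-4) by (simp add: eval_leq_iff)
qed

end

section \<open>Isomorphic copies and generated varieties\<close>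

lemma satisfies_surj_hom:
  assumes A: "ai_semiring A" and surj: "h ` carrier A = carrier B"
    and hom: "\<And>x y. \<lbrakk>x \<in> carrier A; y \<in> carrier A\<rbrakk> \<Longrightarrow>
      h (x \<oplus>\<^bsub>A\<^esub> y) = h x \<oplus>\<^bsub>B\<^esub> h y \<and> h (x \<otimes>\<^bsub>A\<^esub> y) = h x \<otimes>\<^bsub>B\<^esub> h y"
    and sat: "satisfies A e"
  shows "satisfies B e"
  unfolding satisfies_def
proof (intro allI impI)
  interpret A: ai_semiring A by (rule A)
  fix \<rho> :: "nat \<Rightarrow> 'b" assume "range \<rho> \<subseteq> carrier B"
  then have "\<forall>i. \<exists>x. x \<in> carrier A \<and> h x = \<rho> i"
    using surj by (metis imageE range_subsetD)
  then obtain \<sigma> where \<sigma>: "\<And>i. \<sigma> i \<in> carrier A" "\<And>i. h (\<sigma> i) = \<rho> i"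
    by metis
  have "eval B \<rho> t = h (eval A \<sigma> t)" for t
    by (induction t) (use \<sigma> hom A.eval_closed[of \<sigma>] in \<open>auto simp: image_subset_iff\<close>)
  moreover have "eval A \<sigma> (fst e) = eval A \<sigma> (snd e)"
    using sat \<sigma> by (auto simp: satisfies_def)
  ultimately show "eval B \<rho> (fst e) = eval B \<rho> (snd e)" by simp
qed

lemma satisfies_isomorphic_iff:
  assumes A: "ai_semiring A" and B: "ai_semiring B" and "isomorphic A B"
  shows "satisfies A e \<longleftrightarrow> satisfies B e"
proof -
  interpret A: ai_semiring A by (rule A)
  obtain h where bij: "bij_betw h (carrier A) (carrier B)"
    and hom: "\<And>x y. \<lbrakk>x \<in> carrier A; y \<in> carrier A\<rbrakk> \<Longrightarrow>
      h (x \<oplus>\<^bsub>A\<^esub> y) = h x \<oplus>\<^bsub>B\<^esub> h y \<and> h (x \<otimes>\<^bsub>A\<^esub> y) = h x \<otimes>\<^bsub>B\<^esub> h y"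
    using assms(3) unfolding isomorphic_def by blast
  have surj: "h ` carrier A = carrier B"
    using bij by (rule bij_betw_imp_surj_on)
  define g where "g = inv_into (carrier A) h"
  have g_surj: "g ` carrier B = carrier A"
    unfolding g_def by (rule bij_betw_imp_surj_on[OF bij_betw_inv_into[OF bij]])
  have gh: "g (h x) = x" if "x \<in> carrier A" for x
    unfolding g_def using bij_betw_inv_into_left[OF bij that] .
  have g_hom: "g (x \<oplus>\<^bsub>B\<^esub> y) = g x \<oplus>\<^bsub>A\<^esub> g y \<and> g (x \<otimes>\<^bsub>B\<^esub> y) = g x \<otimes>\<^bsub>A\<^esub> g y"
    if x: "x \<in> carrier B" and y: "y \<in> carrier B" for x y
  proof -
    obtain a where a: "a \<in> carrier A" "x = h a" using x surj by force
    obtain b where b: "b \<in> carrier A" "y = h b" using y surj by force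
    have "x \<oplus>\<^bsub>B\<^esub> y = h (a \<oplus>\<^bsub>A\<^esub> b)" "x \<otimes>\<^bsub>B\<^esub> y = h (a \<otimes>\<^bsub>A\<^esub> b)"
      using hom[OF a(1) b(1)] a b by simp_all
    then show ?thesis
      using a b by (simp add: gh A.add_closed A.mult_closed)
  qed
  show ?thesis
    using satisfies_surj_hom[OF A surj hom] satisfies_surj_hom[OF B g_surj g_hom] by (rule iffI)
qed

lemma ex_isomorphic_copy:
  fixes B :: "'b sralg"
  assumes "infinite (UNIV :: 'u set)" and B: "ai_semiring B" and fin: "finite (carrier B)"
  shows "\<exists>A :: 'u sralg. ai_semiring A \<and> isomorphic A B \<and> finite (carrier A)"
proof -
  interpret B: ai_semiring B by (rule B)
  obtain f :: "'b \<Rightarrow> 'u" where f: "inj_on f (carrier B)"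
    using assms(1) fin by (metis (mono_tags) UNIV_I card_le_inj infinite_arbitrarily_large
        inj_on_iff_card_le order_refl)
  define g where "g = inv_into (carrier B) f"
  have g: "g (f x) = x" if "x \<in> carrier B" for x
    using f that by (simp add: g_def)
  define A where "A = \<lparr>carrier = f ` carrier B,
    add = (\<lambda>x y. f (g x \<oplus>\<^bsub>B\<^esub> g y)), mult = (\<lambda>x y. f (g x \<otimes>\<^bsub>B\<^esub> g y))\<rparr>"
  have "bij_betw g (carrier A) (carrier B)"
    by (rule bij_betw_byWitness[where f' = f]) (auto simp: A_def g)
  then have "isomorphic A B"
    unfolding isomorphic_def
    by (intro exI[of _ g]) (auto simp: A_def g B.add_closed B.mult_closed)
  moreover have "ai_semiring A"
    using B.nonempty
    by unfold_locales
      (auto simp: A_def g B.add_closed B.mult_closed B.add_assoc B.add_idem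
        B.mult_assoc B.distrib_left B.distrib_right intro!: arg_cong[of _ _ f] B.add_comm)
  ultimately show ?thesis
    using fin by (auto simp: A_def)
qed

lemma generated_variety_eq:
  "ai_semiring A \<Longrightarrow> generated_variety A = defined_by {e. satisfies A e}"
  unfolding generated_variety_def variety_def defined_by_def by auto

section \<open>Domination between words\<close>

text \<open>The words that lie below the sum of the words in \<open>W\<close> as a consequence of \<open>x y = y x\<close> and
\<open>x \<le> x y\<close> alone.\<close>

definition dominated :: "nat list set \<Rightarrow> nat list \<Rightarrow> bool" where
  "dominated W w \<longleftrightarrow> w \<in> W \<or> (\<exists>x y. w = [x, y] \<and> [y, x] \<in> W)
     \<or> (\<exists>x y. w = [x] \<and> ([x, y] \<in> W \<or> [y, x] \<in> W))"

lemma (in ai_semiring) dominated_leq_eval: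
  assumes comm: "\<And>x y. \<lbrakk>x \<in> carrier S; y \<in> carrier S\<rbrakk> \<Longrightarrow> x \<otimes> y = y \<otimes> x"
    and above: "\<And>x y. \<lbrakk>x \<in> carrier S; y \<in> carrier S\<rbrakk> \<Longrightarrow> leq S x (x \<otimes> y)"
    and \<rho>: "range \<rho> \<subseteq> carrier S" and "dominated (words t) w"
  shows "leq S (word_val S \<rho> w) (eval S \<rho> t)"
proof -
  have r: "\<rho> x \<in> carrier S" for x using \<rho> by auto
  have pair: "leq S (\<rho> x \<otimes> \<rho> y) (eval S \<rho> t)" if "[x, y] \<in> words t \<or> [y, x] \<in> words t" for x y
    using that word_leq_eval[OF \<rho>, of "[x, y]" t] word_leq_eval[OF \<rho>, of "[y, x]" t]
      comm[OF r r, of x y] by auto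
  have single: "leq S (\<rho> x) (eval S \<rho> t)" if "[x, y] \<in> words t \<or> [y, x] \<in> words t" for x y
    using leq_trans[OF r mult_closed[OF r r] eval_closed[OF \<rho>] above[OF r r] pair[OF that]] .
  then show ?thesis
    using assms(4) pair single word_leq_eval[OF \<rho>] unfolding dominated_def by fastforce
qed

section \<open>The identities of TR6\<close>

lemma TR6_mult: "x \<otimes>\<^bsub>TR6\<^esub> y = (if x = 2 \<and> y = 6 \<or> x = 6 \<and> y = 2 \<or> x = 4 \<and> y = 5 \<or> x = 5 \<and> y = 4
    \<or> x = 5 \<and> y = 6 \<or> x = 6 \<and> y = 5 then 3 else 1)"
  by (auto simp: TR6_def doubleton_eq_iff)

lemma TR6_carrier: "carrier TR6 = {1, 2, 3, 4, 5, 6}"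
  by (simp add: TR6_def)

lemma TR6_leq_1: "leq TR6 x 1"
  by (auto simp: leq_def TR6_def)

lemma TR6_leq_3: "x \<in> carrier TR6 \<Longrightarrow> leq TR6 x 3 \<longleftrightarrow> x \<noteq> 1"
  by (auto simp: leq_def TR6_def doubleton_eq_iff)

text \<open>A 2-colouring \<open>c\<close> of the graph of \<open>t\<close> gives an assignment into \<open>{5, 6}\<close> under which \<open>t\<close> does not
exceed \<open>3\<close>. Changing it at no more than two variables, one can send a word that is not dominated to \<open>1\<close>
without moving \<open>t\<close> above \<open>3\<close>. The ends \<open>2\<close> and \<open>4\<close> of the path \<open>2 - 6 - 5 - 4\<close> matter for two
variables of different colours that are not joined by an edge of \<open>t\<close>.\<close>

lemma TR6_word_dominated:
  assumes sat: "satisfies TR6 (s, t)" and w: "w \<in> words s"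
    and short: "\<And>u. u \<in> words t \<Longrightarrow> length u \<le> 2"
    and col: "\<And>x y. [x, y] \<in> words t \<Longrightarrow> c x \<noteq> (c y :: bool)"
  shows "dominated (words t) w"
proof (rule ccontr)
  interpret TR6: ai_semiring TR6 by (rule ai_semiring_TR6)
  assume nd: "\<not> dominated (words t) w"
  have sep: False
    if r: "range \<rho> \<subseteq> carrier TR6" and bad: "word_val TR6 \<rho> w = 1"
      and one: "\<And>x. [x] \<in> words t \<Longrightarrow> \<rho> x \<noteq> 1"
      and two: "\<And>x y. [x, y] \<in> words t \<Longrightarrow> \<rho> x \<otimes>\<^bsub>TR6\<^esub> \<rho> y = 3" for \<rho>
  proof -
    have "leq TR6 (word_val TR6 \<rho> u) 3" if u: "u \<in> words t" for u
    proof (rule short_word_cases[OF u short[OF u]])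
      fix x assume "u = [x]"
      moreover have "\<rho> x \<in> carrier TR6" using r by (rule range_subsetD)
      ultimately show ?thesis using one u TR6_leq_3 by fastforce
    next
      fix x y assume "u = [x, y]"
      then show ?thesis using two[of x y] u TR6_leq_3[of 3] by (simp add: TR6_carrier)
    qed
    from TR6.satisfies_word_leq[OF sat r _ w this]
    have "leq TR6 1 3" by (simp add: TR6_carrier bad)
    then show False using TR6_leq_3[of 1] by (simp add: TR6_carrier)
  qed
  define \<gamma> :: "nat \<Rightarrow> nat" where "\<gamma> x = (if c x then 5 else 6)" for x
  have \<gamma>: "\<gamma> x \<noteq> 1" "\<gamma> x \<in> carrier TR6" for x
    by (auto simp: \<gamma>_def TR6_carrier)
  have \<gamma>_edge: "\<gamma> x \<otimes>\<^bsub>TR6\<^esub> \<gamma> y = 3" if "[x, y] \<in> words t" for x y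
    using col[OF that] by (auto simp: \<gamma>_def TR6_mult)
  have "w \<noteq> []" using w words_not_Nil by metis
  then show False
  proof (cases w rule: word_length_cases)
    case (1 x)
    then have "[x] \<notin> words t" "\<And>y. [x, y] \<notin> words t" "\<And>y. [y, x] \<notin> words t"
      using nd by (auto simp: dominated_def)
    note x = this
    show False
    \<comment> \<open>The variable \<open>x\<close> occurs in no word of \<open>t\<close>, so its value is free.\<close>
    proof (rule sep)
      show "range (\<gamma>(x := 1)) \<subseteq> carrier TR6" using \<gamma>(2) by (auto simp: TR6_carrier)
      show "word_val TR6 (\<gamma>(x := 1)) w = 1" using 1 by simp
      show "(\<gamma>(x := 1)) u \<noteq> 1" if "[u] \<in> words t" for u using x \<gamma> that by auto
      show "(\<gamma>(x := 1)) u \<otimes>\<^bsub>TR6\<^esub> (\<gamma>(x := 1)) v = 3" if "[u, v] \<in> words t" for u v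
        using x \<gamma>_edge[OF that] that by auto
    qed
  next
    case (2 x y)
    then have xy: "[x, y] \<notin> words t" "[y, x] \<notin> words t"
      using nd by (auto simp: dominated_def)
    show False
    proof (cases "c x = c y")
      case True
      show False
      proof (rule sep)
        show "range \<gamma> \<subseteq> carrier TR6" using \<gamma>(2) by blast
        show "word_val TR6 \<gamma> w = 1" using True 2 by (simp add: \<gamma>_def TR6_mult)
      qed (rule \<gamma>(1), erule \<gamma>_edge)
    next
      case False
      \<comment> \<open>Both variables move to the ends of the path. Each end has its inner neighbour in common
        with the vertex that it replaces, so the product of the two ends is the only one lost.\<close>
      define \<delta> where "\<delta> z = (if z = x \<or> z = y then if c z then 2 else 4 else \<gamma> z)" for z
      show False
      proof (rule sep)
        show "range \<delta> \<subseteq> carrier TR6" by (auto simp: \<delta>_def \<gamma>_def TR6_carrier)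
        show "word_val TR6 \<delta> w = 1" using False 2 by (simp add: \<delta>_def TR6_mult)
        show "\<delta> u \<noteq> 1" for u by (simp add: \<delta>_def \<gamma>_def)
        fix u v assume uv: "[u, v] \<in> words t"
        have "\<not> (u \<in> {x, y} \<and> v \<in> {x, y})"
          using uv xy col[OF uv] by auto
        then show "\<delta> u \<otimes>\<^bsub>TR6\<^esub> \<delta> v = 3"
          using col[OF uv] by (cases "c u"; cases "c v") (auto simp: \<delta>_def \<gamma>_def TR6_mult)
      qed
    qed
  next
    case (3 x y z v)
    show False
    proof (rule sep)
      show "range \<gamma> \<subseteq> carrier TR6" using \<gamma>(2) by blast
      show "word_val TR6 \<gamma> w = 1" using 3 by (simp add: TR6_mult)
    qed (rule \<gamma>(1), erule \<gamma>_edge)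
  qed
qed

section \<open>Odd cycles\<close>

definition cycle_adj :: "nat \<Rightarrow> nat \<Rightarrow> nat \<Rightarrow> bool" where
  "cycle_adj n i j \<longleftrightarrow> j = Suc i mod n \<or> i = Suc j mod n"

definition cycle_words :: "nat \<Rightarrow> nat list set" where
  "cycle_words n = (\<lambda>i. [i, Suc i mod n]) ` {..<n}"

lemma odd_cycle_not_2_colourable:
  assumes "odd n"
  shows "\<exists>i<n. c i = (c (Suc i mod n) :: bool)"
proof (rule ccontr)
  assume none: "\<not> ?thesis"
  have alt: "c (Suc i mod n) = (\<not> c i)" if "i < n" for i
    using none that by blast
  have even: "c i = (c 0 = even i)" if "i < n" for i
    using that
  proof (induction i)
    case 0
    show ?case by simp
  next
    case (Suc i)
    then have "c (Suc i) = (\<not> c i)" using alt[of i] by simp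
    moreover have "c i = (c 0 = even i)" using Suc by simp
    ultimately show ?case by simp
  qed
  obtain m where m: "n = Suc m" "even m" using assms by (cases n) simp_all
  then have "c 0 = (\<not> c m)" using alt[of m] by simp
  moreover have "c m = c 0" using even[of m] m by simp
  ultimately show False by blast
qed

text \<open>Removing the vertex \<open>k\<close> leaves the path \<open>k + 1, \<dots>, n - 1, n, \<dots>, n + k - 1\<close>, where the vertices below
\<open>k\<close> are written with the summand \<open>n\<close>. Parity alternates along it, whatever the parity of \<open>n\<close>.\<close>

lemma cycle_minus_vertex_2_colouring:
  assumes "cycle_adj n i j" "i < n" "j < n" "k < n" "i \<noteq> k" "j \<noteq> k"
  shows "even (if i < k then i + n else i) \<noteq> even (if j < k then j + n else j)"
proof -
  have *: "even (if i < k then i + n else i) \<noteq> even (if j < k then j + n else j)"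
    if "j = Suc i mod n" "i < n" "i \<noteq> k" "j \<noteq> k" for i j
  proof (cases "Suc i = n")
    case True
    then show ?thesis using that \<open>k < n\<close> by auto
  next
    case False
    then have "j = Suc i" using that by simp
    then show ?thesis using that by auto
  qed
  then show ?thesis
    using assms *[of j i] *[of i j] unfolding cycle_adj_def by metis
qed

text \<open>If the cycle sum were not \<open>1\<close>, the assignment would map the cycle to the path \<open>2 - 6 - 5 - 4\<close>, and
the colour classes \<open>{2, 5}\<close> and \<open>{4, 6}\<close> of the path would pull back to a 2-colouring of the cycle.\<close>

lemma TR6_odd_cycle:
  assumes "odd n" "words t = cycle_words n"
  shows "satisfies TR6 (Add r t, t)"
proof -
  interpret TR6: ai_semiring TR6 by (rule ai_semiring_TR6)
  have "eval TR6 \<rho> t = 1" if \<rho>: "range \<rho> \<subseteq> carrier TR6" for \<rho>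
  proof (rule ccontr)
    assume "eval TR6 \<rho> t \<noteq> 1"
    then have "leq TR6 (eval TR6 \<rho> t) 3"
      using TR6.eval_closed[OF \<rho>] by (simp add: TR6_leq_3)
    then have all: "\<forall>w\<in>cycle_words n. leq TR6 (word_val TR6 \<rho> w) 3"
      using TR6.eval_leq_iff[OF \<rho>] assms(2) by (simp add: TR6_carrier)
    obtain i where "i < n" and i: "(\<rho> i \<in> {2, 5}) = (\<rho> (Suc i mod n) \<in> {2, 5})"
      using odd_cycle_not_2_colourable[OF assms(1), of "\<lambda>i. \<rho> i \<in> {2, 5}"] by blast
    then have "leq TR6 (\<rho> i \<otimes>\<^bsub>TR6\<^esub> \<rho> (Suc i mod n)) 3"
      using all by (auto simp: cycle_words_def)
    then show False
      using i by (auto simp: TR6_mult TR6_leq_3 TR6_carrier split: if_splits)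
  qed
  moreover have "x \<oplus>\<^bsub>TR6\<^esub> 1 = 1" for x
    using TR6_leq_1 by (simp add: leq_def)
  ultimately show ?thesis
    by (auto simp: satisfies_def)
qed

section \<open>The cycle algebras\<close>

text \<open>Elements are nonempty vertex sets of the cycle, added by union, and two further elements on top of
them, \<open>Edge < Top\<close>. The product of two vertex sets is \<open>Edge\<close> if they are completely joined, and all
other products are \<open>Top\<close>. Distributivity holds because \<open>Z\<close> is completely joined to \<open>X \<union> Y\<close> iff it is
so to both \<open>X\<close> and \<open>Y\<close>.\<close>

datatype cyc = Part "nat set" | Edge | Top

fun cyc_add :: "cyc \<Rightarrow> cyc \<Rightarrow> cyc" where
  "cyc_add (Part X) (Part Y) = Part (X \<union> Y)"
| "cyc_add Top b = Top"
| "cyc_add a Top = Top"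
| "cyc_add a b = Edge"

fun cyc_mult :: "nat \<Rightarrow> cyc \<Rightarrow> cyc \<Rightarrow> cyc" where
  "cyc_mult n (Part X) (Part Y) = (if \<forall>i\<in>X. \<forall>j\<in>Y. cycle_adj n i j then Edge else Top)"
| "cyc_mult n a b = Top"

definition cycle_algebra :: "nat \<Rightarrow> cyc sralg" where
  "cycle_algebra n = \<lparr>carrier = insert Edge (insert Top (Part ` {X. X \<noteq> {} \<and> X \<subseteq> {..<n}})),
     add = cyc_add, mult = cyc_mult n\<rparr>"

lemma cyc_mult_cases: "cyc_mult n a b = Edge \<or> cyc_mult n a b = Top"
  by (cases a; cases b) auto

lemma cyc_mult_mult:
  "cyc_mult n (cyc_mult n a b) d = Top" "cyc_mult n d (cyc_mult n a b) = Top"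
  using cyc_mult_cases[of n a b] by (cases d; auto)+

lemma cyc_mult_comm: "cyc_mult n a b = cyc_mult n b a"
  by (cases a; cases b) (auto simp: cycle_adj_def)

lemma cyc_distrib: "cyc_mult n a (cyc_add b d) = cyc_add (cyc_mult n a b) (cyc_mult n a d)"
  by (cases a; cases b; cases d) auto

lemma ai_semiring_cycle_algebra: "ai_semiring (cycle_algebra n)"
proof
  fix x y z
  show "carrier (cycle_algebra n) \<noteq> {}"
    by (simp add: cycle_algebra_def)
  show "x \<oplus>\<^bsub>cycle_algebra n\<^esub> y \<in> carrier (cycle_algebra n)"
    if "x \<in> carrier (cycle_algebra n)" "y \<in> carrier (cycle_algebra n)"
    using that by (auto simp: cycle_algebra_def)
  show "x \<otimes>\<^bsub>cycle_algebra n\<^esub> y \<in> carrier (cycle_algebra n)"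
    using cyc_mult_cases[of n x y] by (auto simp: cycle_algebra_def)
  show "x \<oplus>\<^bsub>cycle_algebra n\<^esub> y \<oplus>\<^bsub>cycle_algebra n\<^esub> z
      = x \<oplus>\<^bsub>cycle_algebra n\<^esub> (y \<oplus>\<^bsub>cycle_algebra n\<^esub> z)"
    by (cases x; cases y; cases z) (auto simp: cycle_algebra_def)
  show "x \<oplus>\<^bsub>cycle_algebra n\<^esub> y = y \<oplus>\<^bsub>cycle_algebra n\<^esub> x"
    by (cases x; cases y) (auto simp: cycle_algebra_def)
  show "x \<oplus>\<^bsub>cycle_algebra n\<^esub> x = x"
    by (cases x) (auto simp: cycle_algebra_def)
qed (auto simp: cycle_algebra_def cyc_mult_mult cyc_distrib cyc_mult_comm[of n "cyc_add _ _"]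
    cyc_mult_comm)

lemma finite_cycle_algebra: "finite (carrier (cycle_algebra n))"
proof -
  have "finite {X. X \<noteq> {} \<and> X \<subseteq> {..<n}}"
    by (rule finite_subset[of _ "Pow {..<n}"]) auto
  then show ?thesis by (simp add: cycle_algebra_def)
qed

lemma cycle_leq_Edge: "leq (cycle_algebra n) a Edge \<longleftrightarrow> a \<noteq> Top"
  by (cases a) (auto simp: leq_def cycle_algebra_def)

lemma cycle_leq_Top: "leq (cycle_algebra n) a Top"
  by (cases a) (auto simp: leq_def cycle_algebra_def)

text \<open>If the value of \<open>t\<close> is not \<open>Top\<close>, choosing a vertex from each set that occurs maps the graph of \<open>t\<close>
to the cycle. With fewer than \<open>n\<close> variables a vertex \<open>k\<close> is missed, and the colouring of the
remaining path pulls back to \<open>t\<close>. Thus the word is dominated, which suffices because the algebra is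
commutative with \<open>x \<le> x y\<close>.\<close>

lemma cycle_algebra_word_leq:
  assumes sat: "satisfies TR6 (s, t)" and w: "w \<in> words s"
    and few: "card (\<Union>(set ` words t)) < n"
    and \<rho>: "range \<rho> \<subseteq> carrier (cycle_algebra n)"
  shows "leq (cycle_algebra n) (word_val (cycle_algebra n) \<rho> w) (eval (cycle_algebra n) \<rho> t)"
proof (cases "eval (cycle_algebra n) \<rho> t = Top")
  case True
  then show ?thesis by (simp add: cycle_leq_Top)
next
  case False
  interpret B: ai_semiring "cycle_algebra n" by (rule ai_semiring_cycle_algebra)
  have "leq (cycle_algebra n) (eval (cycle_algebra n) \<rho> t) Edge"
    using False by (simp add: cycle_leq_Edge)
  then have nTop: "word_val (cycle_algebra n) \<rho> u \<noteq> Top" if "u \<in> words t" for u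
    using B.eval_leq_iff[OF \<rho>, of Edge t] that cycle_leq_Edge by (auto simp: cycle_algebra_def)
  have short: "length u \<le> 2" if "u \<in> words t" for u
  proof (rule ccontr)
    assume long: "\<not> length u \<le> 2"
    then have "u \<noteq> []" by auto
    then have "word_val (cycle_algebra n) \<rho> u = Top"
      by (cases u rule: word_length_cases)
        (use long cyc_mult_mult in \<open>auto simp: cycle_algebra_def\<close>)
    then show False using nTop[OF that] by simp
  qed
  \<comment> \<open>The \<open>0\<close> is a dummy: a variable whose value is not a vertex set occurs in no edge.\<close>
  define f where "f x = (case \<rho> x of Part X \<Rightarrow> (SOME i. i \<in> X) | _ \<Rightarrow> 0)" for x
  define F where "F = f ` \<Union>(set ` words t)"
  have "card F < n"
    using few card_image_le[of "\<Union>(set ` words t)" f] by (simp add: F_def finite_words)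
  then obtain k where k: "k < n" "k \<notin> F"
    by (metis card_lessThan card_mono finite_UN finite_imageI finite_set finite_words F_def
        lessThan_iff not_le subsetI)
  define c where "c x = even (if f x < k then f x + n else f x)" for x
  have col: "c x \<noteq> c y" if e: "[x, y] \<in> words t" for x y
  proof -
    have "cyc_mult n (\<rho> x) (\<rho> y) \<noteq> Top"
      using nTop[OF e] by (simp add: cycle_algebra_def)
    then obtain X Y where XY: "\<rho> x = Part X" "\<rho> y = Part Y" "\<forall>i\<in>X. \<forall>j\<in>Y. cycle_adj n i j"
      by (cases "\<rho> x"; cases "\<rho> y") (auto split: if_splits)
    have "\<rho> x \<in> carrier (cycle_algebra n)" "\<rho> y \<in> carrier (cycle_algebra n)"
      using \<rho> by auto
    then have "X \<noteq> {}" "Y \<noteq> {}" "X \<subseteq> {..<n}" "Y \<subseteq> {..<n}"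
      using XY by (auto simp: cycle_algebra_def)
    then have "f x \<in> X" "f y \<in> Y"
      using XY by (auto simp: f_def some_in_eq)
    moreover have "f x \<in> F" "f y \<in> F"
      using e by (auto simp: F_def intro!: imageI bexI[of _ "[x, y]"])
    ultimately show ?thesis
      unfolding c_def using XY(3) \<open>X \<subseteq> _\<close> \<open>Y \<subseteq> _\<close> k
      by (intro cycle_minus_vertex_2_colouring) auto
  qed
  have "dominated (words t) w"
    using sat w short col by (rule TR6_word_dominated)
  then show ?thesis
  proof (rule B.dominated_leq_eval[rotated 3])
    show "leq (cycle_algebra n) x (x \<otimes>\<^bsub>cycle_algebra n\<^esub> y)" for x y
    proof (cases "x = Top")
      case True
      then show ?thesis by (simp add: leq_def cycle_algebra_def)
    next
      case False
      then show ?thesis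
        using cyc_mult_cases[of n x y] cycle_leq_Edge[of n x] cycle_leq_Top[of n x]
        by (auto simp: cycle_algebra_def)
    qed
  qed (use \<rho> in \<open>auto simp: cycle_algebra_def cyc_mult_comm\<close>)
qed

lemma cycle_algebra_satisfies:
  assumes "satisfies TR6 (s, t)"
    and "card (\<Union>(set ` words s)) < n" "card (\<Union>(set ` words t)) < n"
  shows "satisfies (cycle_algebra n) (s, t)"
proof -
  interpret B: ai_semiring "cycle_algebra n" by (rule ai_semiring_cycle_algebra)
  have "satisfies TR6 (t, s)"
    using assms(1) by (auto simp: satisfies_def)
  then show ?thesis
    using assms by (intro B.satisfies_wordsI cycle_algebra_word_leq)
qed

text \<open>Sending each variable to its own vertex keeps the cycle sum at \<open>Edge\<close>, whereas a cube is \<open>Top\<close>.\<close>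

lemma cycle_algebra_not_satisfies:
  assumes "n > 0" "words t = cycle_words n"
  shows "\<not> satisfies (cycle_algebra n) (Add (Mult (Var 0) (Mult (Var 0) (Var 0))) t, t)"
proof
  interpret B: ai_semiring "cycle_algebra n" by (rule ai_semiring_cycle_algebra)
  define \<rho> where "\<rho> i = Part {i mod n}" for i
  have \<rho>: "range \<rho> \<subseteq> carrier (cycle_algebra n)"
  proof
    fix a assume "a \<in> range \<rho>"
    then obtain i where "a = Part {i mod n}" by (auto simp: \<rho>_def)
    moreover have "{i mod n} \<subseteq> {..<n}" using assms(1) by simp
    ultimately show "a \<in> carrier (cycle_algebra n)"
      by (simp add: cycle_algebra_def)
  qed
  let ?r = "Mult (Var 0) (Mult (Var 0) (Var 0))"
  have edges: "leq (cycle_algebra n) (word_val (cycle_algebra n) \<rho> w) Edge" if w: "w \<in> words t" for w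
  proof -
    obtain i where "i < n" "w = [i, Suc i mod n]"
      using w assms(2) by (auto simp: cycle_words_def)
    then have "word_val (cycle_algebra n) \<rho> w = Edge"
      by (simp add: \<rho>_def cycle_algebra_def cycle_adj_def)
    then show ?thesis by (simp add: cycle_leq_Edge)
  qed
  assume "satisfies (cycle_algebra n) (Add ?r t, t)"
  then have "leq (cycle_algebra n) (word_val (cycle_algebra n) \<rho> [0, 0, 0]) Edge"
  proof (rule B.satisfies_word_leq[OF _ \<rho>])
    show "Edge \<in> carrier (cycle_algebra n)" by (simp add: cycle_algebra_def)
    show "[0, 0, 0] \<in> words (Add ?r t)" by simp
  qed (rule edges)
  then show False
    unfolding cycle_leq_Edge by (simp add: cycle_algebra_def cyc_mult_mult)
qed

lemma not_finitely_based_TR6: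
  fixes T :: "'u sralg"
  assumes inf: "infinite (UNIV :: 'u set)" and T: "ai_semiring T" "isomorphic T TR6"
  shows "\<not> finitely_based T"
proof
  note satT = satisfies_isomorphic_iff[OF T(1) ai_semiring_TR6 T(2)]
  assume "finitely_based T"
  then obtain \<Sigma> where fin: "finite \<Sigma>" and \<Sigma>: "generated_variety T = defined_by \<Sigma>"
    unfolding finitely_based_def finitely_based_variety_def by blast
  have TR6_\<Sigma>: "satisfies TR6 e" if "e \<in> \<Sigma>" for e
    using variety_generated_variety(2)[OF T(1)] \<Sigma> that satT by (auto simp: defined_by_def)
  define V where "V = (\<Union>e\<in>\<Sigma>. \<Union>(set ` (words (fst e) \<union> words (snd e))))"
  have "finite V" using fin by (auto simp: V_def finite_words)
  \<comment> \<open>Odd, and larger than the number of variables in any identity of \<open>\<Sigma>\<close>.\<close>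
  define n where "n = 2 * card V + 1"
  have sat: "satisfies (cycle_algebra n) e" if e: "e \<in> \<Sigma>" for e
  proof -
    obtain s t where st: "e = (s, t)" by fastforce
    have "\<Union>(set ` words s) \<subseteq> V" "\<Union>(set ` words t) \<subseteq> V"
      using e unfolding V_def st by fastforce+
    then have "card (\<Union>(set ` words s)) \<le> card V" "card (\<Union>(set ` words t)) \<le> card V"
      by (simp_all add: card_mono[OF \<open>finite V\<close>])
    then show ?thesis
      using TR6_\<Sigma>[OF e] unfolding st n_def by (intro cycle_algebra_satisfies) auto
  qed
  obtain B :: "'u sralg" where B: "ai_semiring B" "isomorphic B (cycle_algebra n)"
    using ex_isomorphic_copy[OF inf ai_semiring_cycle_algebra finite_cycle_algebra] by blast
  note satB = satisfies_isomorphic_iff[OF B(1) ai_semiring_cycle_algebra B(2)]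
  have "B \<in> generated_variety T"
    using sat satB B(1) unfolding \<Sigma> defined_by_def by auto
  then have "satisfies B e" if "satisfies T e" for e
    using that unfolding generated_variety_eq[OF T(1)] defined_by_def by blast
  then have TB: "satisfies (cycle_algebra n) e" if "satisfies TR6 e" for e
    using that unfolding satT satB by blast
  have "\<exists>t. words t = cycle_words n"
    by (rule ex_term_with_words) (auto simp: cycle_words_def n_def)
  then obtain t where t: "words t = cycle_words n" by blast
  show False
    using TB[OF TR6_odd_cycle[OF _ t]] cycle_algebra_not_satisfies[OF _ t] by (auto simp: n_def)
qed

section \<open>A finitely based chain whose variety contains TR6\<close>

text \<open>The elements \<open>0\<close> and \<open>1\<close> are two adjacent vertices, of which only \<open>0\<close> has a loop; \<open>2\<close> is the value
of an edge and \<open>3\<close> the largest element. The product is a monotone function of \<open>x + y\<close>, so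
it distributes over maxima.\<close>

definition chain4 :: "nat sralg" where
  "chain4 = \<lparr>carrier = {..3}, add = max, mult = (\<lambda>x y. if x + y \<le> 1 then 2 else 3)\<rparr>"

text \<open>Besides commutativity these are the inequalities \<open>x \<le> x y\<close>, \<open>u \<le> x y z\<close> and
\<open>x y \<le> x x + y z\<close>. The last one holds in the chain because its right-hand side is \<open>3\<close> unless
\<open>x = 0\<close> and \<open>y \<in> {0, 1}\<close>, and \<open>0\<close> is adjacent to both of these values.\<close>

definition chain_basis :: "identity set" where
  "chain_basis = (let x = Var 0; y = Var 1; z = Var 2; u = Var 3 in
    {(Mult x y, Mult y x),
     (Add x (Mult x y), Mult x y),
     (Add u (Mult x (Mult y z)), Mult x (Mult y z)),
     (Add (Mult x y) (Add (Mult x x) (Mult y z)), Add (Mult x x) (Mult y z))})"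

lemma ai_semiring_chain4: "ai_semiring chain4"
  by unfold_locales (auto simp: chain4_def)

lemma chain4_leq: "leq chain4 x y \<longleftrightarrow> x \<le> y"
  by (auto simp: leq_def chain4_def)

lemma chain4_simps:
  "x \<in> carrier chain4 \<longleftrightarrow> x \<le> 3"
  "x \<otimes>\<^bsub>chain4\<^esub> y = (if x + y \<le> 1 then 2 else 3)"
  by (simp_all add: chain4_def)

lemma satisfies_chain_basis_iff:
  "(\<forall>e\<in>chain_basis. satisfies S e) \<longleftrightarrow>
   (\<forall>x\<in>carrier S. \<forall>y\<in>carrier S. \<forall>z\<in>carrier S. \<forall>u\<in>carrier S.
      x \<otimes>\<^bsub>S\<^esub> y = y \<otimes>\<^bsub>S\<^esub> x \<and> leq S x (x \<otimes>\<^bsub>S\<^esub> y) \<and> leq S u (x \<otimes>\<^bsub>S\<^esub> (y \<otimes>\<^bsub>S\<^esub> z))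
      \<and> leq S (x \<otimes>\<^bsub>S\<^esub> y) (x \<otimes>\<^bsub>S\<^esub> x \<oplus>\<^bsub>S\<^esub> y \<otimes>\<^bsub>S\<^esub> z))" (is "?L = ?R")
proof
  assume L: ?L
  show ?R
  proof (intro ballI)
    fix x y z u
    assume *: "x \<in> carrier S" "y \<in> carrier S" "z \<in> carrier S" "u \<in> carrier S"
    define \<rho> where "\<rho> i = (if i = 0 then x else if i = 1 then y else if i = 2 then z else u)"
      for i :: nat
    have "range \<rho> \<subseteq> carrier S" using * by (auto simp: \<rho>_def)
    then have "\<forall>e\<in>chain_basis. eval S \<rho> (fst e) = eval S \<rho> (snd e)"
      using L by (simp add: satisfies_def)
    then show "x \<otimes>\<^bsub>S\<^esub> y = y \<otimes>\<^bsub>S\<^esub> x \<and> leq S x (x \<otimes>\<^bsub>S\<^esub> y) \<and> leq S u (x \<otimes>\<^bsub>S\<^esub> (y \<otimes>\<^bsub>S\<^esub> z))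
      \<and> leq S (x \<otimes>\<^bsub>S\<^esub> y) (x \<otimes>\<^bsub>S\<^esub> x \<oplus>\<^bsub>S\<^esub> y \<otimes>\<^bsub>S\<^esub> z)"
      by (simp (no_asm_use) add: chain_basis_def Let_def \<rho>_def leq_def)
  qed
next
  assume R: ?R
  have "eval S \<rho> (fst e) = eval S \<rho> (snd e)"
    if "e \<in> chain_basis" and \<rho>: "range \<rho> \<subseteq> carrier S" for e \<rho>
  proof -
    have "\<rho> i \<in> carrier S" for i using \<rho> by auto
    then have "\<rho> 0 \<otimes>\<^bsub>S\<^esub> \<rho> 1 = \<rho> 1 \<otimes>\<^bsub>S\<^esub> \<rho> 0"
      and "leq S (\<rho> 0) (\<rho> 0 \<otimes>\<^bsub>S\<^esub> \<rho> 1)"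
      and "leq S (\<rho> 3) (\<rho> 0 \<otimes>\<^bsub>S\<^esub> (\<rho> 1 \<otimes>\<^bsub>S\<^esub> \<rho> 2))"
      and "leq S (\<rho> 0 \<otimes>\<^bsub>S\<^esub> \<rho> 1) (\<rho> 0 \<otimes>\<^bsub>S\<^esub> \<rho> 0 \<oplus>\<^bsub>S\<^esub> \<rho> 1 \<otimes>\<^bsub>S\<^esub> \<rho> 2)"
      using R by blast+
    then show ?thesis
      using that(1) unfolding chain_basis_def Let_def leq_def by (elim insertE) simp_all
  qed
  then show ?L by (simp add: satisfies_def)
qed

lemma chain4_satisfies_basis: "\<forall>e\<in>chain_basis. satisfies chain4 e"
  unfolding satisfies_chain_basis_iff chain4_leq by (auto simp: chain4_def)

lemma TR6_satisfies_basis: "\<forall>e\<in>chain_basis. satisfies TR6 e"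
proof -
  have "leq TR6 (x \<otimes>\<^bsub>TR6\<^esub> y) (x \<otimes>\<^bsub>TR6\<^esub> x \<oplus>\<^bsub>TR6\<^esub> y \<otimes>\<^bsub>TR6\<^esub> z)" for x y z
  proof -
    have "x \<otimes>\<^bsub>TR6\<^esub> x \<oplus>\<^bsub>TR6\<^esub> y \<otimes>\<^bsub>TR6\<^esub> z = 1" by (auto simp: TR6_def doubleton_eq_iff)
    then show ?thesis using TR6_leq_1 by simp
  qed
  moreover have "leq TR6 u (x \<otimes>\<^bsub>TR6\<^esub> (y \<otimes>\<^bsub>TR6\<^esub> z))" for x y z u
    using TR6_leq_1 by (simp add: TR6_mult)
  moreover have "leq TR6 x (x \<otimes>\<^bsub>TR6\<^esub> y)" if "x \<in> carrier TR6" for x y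
    using that TR6_leq_1 TR6_leq_3[of x] by (auto simp: TR6_mult)
  moreover have "x \<otimes>\<^bsub>TR6\<^esub> y = y \<otimes>\<^bsub>TR6\<^esub> x" for x y
    by (auto simp: TR6_mult)
  ultimately show ?thesis
    unfolding satisfies_chain_basis_iff by blast
qed

text \<open>Sending all variables to \<open>0\<close> keeps \<open>t\<close> below \<open>3\<close>. A variable in no edge can be raised to \<open>2\<close>, and
to \<open>3\<close> if it does not occur at all; two variables in edges can be raised to \<open>1\<close> unless they are
adjacent or one of them has a loop. The last case is the one besides domination.\<close>

lemma chain4_word_cases:
  assumes sat: "satisfies chain4 (s, t)" and w: "w \<in> words s"
    and short: "\<And>u. u \<in> words t \<Longrightarrow> length u \<le> 2"
  shows "dominated (words t) w
    \<or> (\<exists>x y. (w = [x, y] \<or> w = [y, x]) \<and> [x, x] \<in> words t \<and> (\<exists>z. [y, z] \<in> words t \<or> [z, y] \<in> words t))"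
proof (rule ccontr)
  interpret A: ai_semiring chain4 by (rule ai_semiring_chain4)
  assume neg: "\<not> ?thesis"
  have sep: False
    if r: "\<And>x. \<rho> x \<le> 3" and "word_val chain4 \<rho> w = 3"
      and one: "\<And>x. [x] \<in> words t \<Longrightarrow> \<rho> x \<le> 2"
      and two: "\<And>x y. [x, y] \<in> words t \<Longrightarrow> \<rho> x + \<rho> y \<le> 1" for \<rho>
  proof -
    have \<rho>: "range \<rho> \<subseteq> carrier chain4" using r by (auto simp: chain4_simps)
    have "leq chain4 (word_val chain4 \<rho> u) 2" if u: "u \<in> words t" for u
    proof (rule short_word_cases[OF u short[OF u]])
      fix x assume "u = [x]"
      then show ?thesis using one u by (simp add: chain4_leq)
    next
      fix x y assume "u = [x, y]"
      then show ?thesis using two[of x y] u by (simp add: chain4_leq chain4_simps)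
    qed
    then have "leq chain4 (word_val chain4 \<rho> w) 2"
      by (intro A.satisfies_word_leq[OF sat \<rho> _ w]) (simp_all add: chain4_simps)
    then show False using that(2) by (simp add: chain4_leq)
  qed
  have "w \<noteq> []" using w words_not_Nil by metis
  then show False
  proof (cases w rule: word_length_cases)
    case (1 x)
    then have "[x] \<notin> words t" "\<And>y. [x, y] \<notin> words t" "\<And>y. [y, x] \<notin> words t"
      using neg by (auto simp: dominated_def)
    then show False
      by (intro sep[of "(\<lambda>_. 0)(x := 3)"]) (use 1 in auto)
  next
    case (2 x y)
    have isolated: False if "p \<in> {x, y}" "\<And>z. [p, z] \<notin> words t" "\<And>z. [z, p] \<notin> words t" for p
      by (rule sep[of "(\<lambda>_. 0)(p := 2)"]) (use 2 that in \<open>auto simp: chain4_simps\<close>)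
    have "[x, y] \<notin> words t" "[y, x] \<notin> words t"
      using neg 2 by (auto simp: dominated_def)
    moreover have "[x, x] \<notin> words t" "[y, y] \<notin> words t"
      using neg 2 isolated[of x] isolated[of y] by blast+
    ultimately show False
      by (intro sep[of "(\<lambda>_. 0)(x := 1, y := 1)"]) (use 2 in \<open>auto simp: chain4_simps\<close>)
  next
    case 3
    then show False
      by (intro sep[of "\<lambda>_. 0"]) (auto simp: chain4_def)
  qed
qed

text \<open>Each case in which the chain has a word below \<open>t\<close> is covered by the basis: a word of length at
least three in \<open>t\<close> by \<open>u \<le> x y z\<close>, domination by commutativity and \<open>x \<le> x y\<close>, and a loop together
with an edge by \<open>x y \<le> x x + y z\<close>.\<close>

lemma chain_basis_word_leq:
  assumes S: "ai_semiring S" and basis: "\<forall>e\<in>chain_basis. satisfies S e"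
    and sat: "satisfies chain4 (s, t)" and w: "w \<in> words s" and \<rho>: "range \<rho> \<subseteq> carrier S"
  shows "leq S (word_val S \<rho> w) (eval S \<rho> t)"
proof -
  interpret S: ai_semiring S by (rule S)
  have comm: "x \<otimes>\<^bsub>S\<^esub> y = y \<otimes>\<^bsub>S\<^esub> x" and above: "leq S x (x \<otimes>\<^bsub>S\<^esub> y)"
    if "x \<in> carrier S" "y \<in> carrier S" for x y
    using basis that unfolding satisfies_chain_basis_iff by blast+
  have top: "leq S u (x \<otimes>\<^bsub>S\<^esub> (y \<otimes>\<^bsub>S\<^esub> z))"
    and square: "leq S (x \<otimes>\<^bsub>S\<^esub> y) (x \<otimes>\<^bsub>S\<^esub> x \<oplus>\<^bsub>S\<^esub> y \<otimes>\<^bsub>S\<^esub> z)"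
    if "x \<in> carrier S" "y \<in> carrier S" "z \<in> carrier S" "u \<in> carrier S" for x y z u
    using basis that unfolding satisfies_chain_basis_iff by blast+
  note E = S.eval_closed[OF \<rho>]
  have r: "\<rho> x \<in> carrier S" for x using \<rho> by auto
  have W: "word_val S \<rho> w \<in> carrier S"
    using S.word_val_closed[OF \<rho>] w words_not_Nil by metis
  show ?thesis
  proof (cases "\<forall>u\<in>words t. length u \<le> 2")
    case False
    then obtain u where u: "u \<in> words t" "\<not> length u \<le> 2" by blast
    then obtain x y v where uxy: "u = [x] @ [y] @ v" "v \<noteq> []"
      by (cases u; cases "tl u") auto
    have "word_val S \<rho> u = \<rho> x \<otimes>\<^bsub>S\<^esub> (\<rho> y \<otimes>\<^bsub>S\<^esub> word_val S \<rho> v)"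
      unfolding uxy using uxy(2) by (simp add: S.word_val_append[OF \<rho>, of "[y]", simplified]
          S.word_val_append[OF \<rho>, of "[x]", simplified])
    moreover have "word_val S \<rho> v \<in> carrier S"
      using S.word_val_closed[OF \<rho> uxy(2)] .
    ultimately have "leq S (word_val S \<rho> w) (word_val S \<rho> u)"
      and "word_val S \<rho> u \<in> carrier S"
      using top r W S.mult_closed by simp_all
    then show ?thesis
      using S.leq_trans[OF W _ E _ S.word_leq_eval[OF \<rho> u(1)]] by blast
  next
    case True
    have dom: "leq S (word_val S \<rho> v) (eval S \<rho> t)" if "dominated (words t) v" for v
      using comm above \<rho> that by (rule S.dominated_leq_eval)
    have pair: "leq S (\<rho> x \<otimes>\<^bsub>S\<^esub> \<rho> y) (eval S \<rho> t)" if "[x, y] \<in> words t \<or> [y, x] \<in> words t" for x y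
      using dom[of "[x, y]"] that by (auto simp: dominated_def)
    from chain4_word_cases[OF sat w] True consider "dominated (words t) w"
      | x y z where "w = [x, y] \<or> w = [y, x]" "[x, x] \<in> words t"
          "[y, z] \<in> words t \<or> [z, y] \<in> words t"
      by blast
    then show ?thesis
    proof cases
      case 1
      then show ?thesis by (rule dom)
    next
      case (2 x y z)
      have "leq S (\<rho> x \<otimes>\<^bsub>S\<^esub> \<rho> x \<oplus>\<^bsub>S\<^esub> \<rho> y \<otimes>\<^bsub>S\<^esub> \<rho> z) (eval S \<rho> t)"
        using pair[of x x] pair[of y z] 2 r E by (simp add: S.add_leq_iff S.mult_closed)
      then have "leq S (\<rho> x \<otimes>\<^bsub>S\<^esub> \<rho> y) (eval S \<rho> t)"
        using S.leq_trans[OF _ _ E square[OF r r r r]] r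
        by (simp add: S.add_closed S.mult_closed)
      then show ?thesis
        using 2(1) comm[OF r r, of x y] by auto
    qed
  qed
qed

lemma chain_basis_complete:
  assumes S: "ai_semiring S" "\<forall>e\<in>chain_basis. satisfies S e" and sat: "satisfies chain4 e"
  shows "satisfies S e"
proof -
  obtain s t where e: "e = (s, t)" by fastforce
  have st: "satisfies chain4 (s, t)" and ts: "satisfies chain4 (t, s)"
    using sat by (auto simp: e satisfies_def)
  show ?thesis
    unfolding e using S(1) chain_basis_word_leq[OF S st] chain_basis_word_leq[OF S ts]
    by (rule ai_semiring.satisfies_wordsI)
qed

lemma not_strongly_nonfinitely_based_TR6:
  fixes T :: "'u sralg"
  assumes inf: "infinite (UNIV :: 'u set)" and T: "ai_semiring T" "isomorphic T TR6"
  shows "\<not> strongly_nonfinitely_based T"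
proof -
  obtain A :: "'u sralg" where A: "ai_semiring A" "isomorphic A chain4" "finite (carrier A)"
    using ex_isomorphic_copy[OF inf ai_semiring_chain4] by (auto simp: chain4_def)
  note satA = satisfies_isomorphic_iff[OF A(1) ai_semiring_chain4 A(2)]
  have V: "generated_variety A = defined_by chain_basis"
    unfolding generated_variety_eq[OF A(1)] defined_by_def
    using satA chain4_satisfies_basis chain_basis_complete by auto
  have "finite chain_basis" by (simp add: chain_basis_def Let_def)
  then have "finitely_based_variety (generated_variety A)"
    unfolding V finitely_based_variety_def by blast
  moreover have "T \<in> generated_variety A"
    unfolding V defined_by_def
    using T TR6_satisfies_basis satisfies_isomorphic_iff[OF T(1) ai_semiring_TR6 T(2)] by auto
  ultimately show ?thesis
    using A unfolding strongly_nonfinitely_based_def finitely_generated_variety_def by blast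
qed

theorem theorem1p2:
  fixes T :: "'u sralg"
  assumes "infinite (UNIV :: 'u set)"
    and "ai_semiring T"
    and "isomorphic T TR6"
  shows "\<not> finitely_based T \<and> \<not> strongly_nonfinitely_based T"
  using not_finitely_based_TR6[OF assms] not_strongly_nonfinitely_based_TR6[OF assms] by blast

end
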